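(* Let $Y$ be a Banach space satisfying the following property: (i) there exists $B\subseteq S_{Y^*}$ such that $\|y\|=\sup_{y^*\in B}|y^*(y)|$ for all $y\in Y$; (ii) for every $\varepsilon >0$ small enough, there exists $\varpi_Y(\varepsilon) >0$ such that for every $y^*\in B$ there exists $y_{y^*,\varepsilon} \in B_{Y}$ with $$\forall t^*\in B: \quad \|t^*- y^*\|\geq \varepsilon \Longrightarrow y^*(y_{y^*,\varepsilon}) -\varpi_Y(\varepsilon) \geq |t^*(y_{y^*,\varepsilon})|.$$ Then, for every Banach space $W$ and for any closed subspace $\mathcal{B}$ of $\mathcal{L}(W,Y)$ containing the space $\mathcal{F}(W, Y)$ of finite rank operators, we have: for every $S \in \mathcal{L}(W,Y)$ the set $$\mathcal{G}(S):=\{ T \in \mathcal{B} : S^*+T^*: Y^*\to W^* \text{ attains strongly its norm on } B \}$$ is the complement of a $\sigma$-porous subset of $\mathcal{B}$. Moreover, the following version of the Bishop–Phelps–Bollobás theorem holds: given $\varepsilon >0$, there exists $\eta(\varepsilon)>0$ such that whenever $T\in \mathcal{B}$ with $\|T\|=\|T^*\|=1$ and $y^*\in B$ satisfy $\|T^*(y^* )\|>1-\eta(\varepsilon)$, there are $S \in \mathcal{B}$ with $\|S\|=\|S^*\|=1$ and $t^* \in B$ such that $$\|S^*(t^* )\|=1, \quad \|t^*-y^*\| < \varepsilon \quad\text{and}\quad \|S-T\|=\|S^*-T^*\|<\varepsilon.$$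
   Context: All Banach spaces are real. $B_Y$ is the closed unit ball of $Y$, and $S_{Y^*}$ is the unit sphere of the topological dual $Y^*$. $\mathcal{L}(W,Y)$ is the space of bounded linear operators from $W$ to $Y$ with the operator norm, $\mathcal{F}(W,Y)$ is its subspace of finite rank operators, and $T^*:Y^*\to W^*$ is the adjoint of $T$. A bounded linear operator $R:Y^*\to W^*$ attains strongly its norm on a subset $B\subseteq S_{Y^*}$ if $\|R\|=\sup\{\|R(y^* )\|:y^*\in B\}$ and there is $y^*_0\in B$ such that the map $y^*\mapsto\|R(y^* )\|$ attains strongly its maximum on $B$ at $y^*_0$, i.e. $\|R(y_0^* )\|=\sup_{y^*\in B}\|R(y^* )\|$ and $\|y^*_n-y^*_0\|\to0$ whenever $(y^*_n)\subseteq B$ and $\|R(y^*_n)\|\to\|R(y^*_0)\|$. "For every $\varepsilon>0$ small enough" means for all $\varepsilon\in(0,\varepsilon_0)$ for some $\varepsilon_0>0$. A subset $P$ of a metric space $(M,d)$ is porous if there exist $\lambda_0\in(0,1]$ and $r_0>0$ such that for any $x\in M$ and $r\in(0,r_0]$ there is $y\in M$ with $\mathring{B}(y;\lambda_0 r)\subseteq \mathring{B}(x;r)\cap (M\setminus P)$, where $\mathring{B}(x;r)$ is the open ball of centre $x$ and radius $r$. A set is $\sigma$-porous if it is a countable union of porous sets.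
   Formalization: The set B is additionally assumed norm-closed, and Y and W nonzero; without closedness of B the claim is false (e.g. Y a plane, W the real line, B a curve missing its corner point), and it also fails for W = 0 when B has at least two points. *)

theory Defs
  imports "HOL-Analysis.Analysis"
begin

lift_definition blinfun_adjoint ::
  "('w::real_normed_vector \<Rightarrow>\<^sub>L 'y::real_normed_vector) \<Rightarrow> ('y \<Rightarrow>\<^sub>L real) \<Rightarrow>\<^sub>L ('w \<Rightarrow>\<^sub>L real)"
  is "\<lambda>T f. f o\<^sub>L T"
  by (rule bounded_bilinear.bounded_linear_left[OF bounded_bilinear_blinfun_compose])

lemma blinfun_adjoint_apply [simp]:
  "blinfun_apply (blinfun_adjoint T) f = f o\<^sub>L T"
  by transfer simp

definition finite_rank :: "('a::real_normed_vector \<Rightarrow>\<^sub>L 'b::real_normed_vector) \<Rightarrow> bool" where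
  "finite_rank T \<longleftrightarrow> (\<exists>A. finite A \<and> range (blinfun_apply T) \<subseteq> span A)"

definition attains_strongly_norm_on ::
  "('a::real_normed_vector \<Rightarrow>\<^sub>L 'b::real_normed_vector) \<Rightarrow> 'a set \<Rightarrow> bool" where
  "attains_strongly_norm_on R B \<longleftrightarrow>
     norm R = (SUP f\<in>B. norm (R f)) \<and>
     (\<exists>f0\<in>B. norm (R f0) = (SUP f\<in>B. norm (R f)) \<and>
        (\<forall>f :: nat \<Rightarrow> 'a. range f \<subseteq> B \<longrightarrow> (\<lambda>n. norm (R (f n))) \<longlonglongrightarrow> norm (R f0) \<longrightarrow>
           (\<lambda>n. norm (f n - f0)) \<longlonglongrightarrow> 0))"

text \<open>Porosity is relative to the subspace \<open>M\<close> of the ambient metric space, so the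
  balls are balls of \<open>M\<close>.\<close>

definition porous_in :: "'a::metric_space set \<Rightarrow> 'a set \<Rightarrow> bool" where
  "porous_in M P \<longleftrightarrow> P \<subseteq> M \<and>
     (\<exists>l0 r0. 0 < l0 \<and> l0 \<le> 1 \<and> 0 < r0 \<and>
        (\<forall>x\<in>M. \<forall>r. 0 < r \<and> r \<le> r0 \<longrightarrow>
           (\<exists>y\<in>M. ball y (l0 * r) \<inter> M \<subseteq> (ball x r \<inter> M) \<inter> (M - P))))"

definition sigma_porous_in :: "'a::metric_space set \<Rightarrow> 'a set \<Rightarrow> bool" where
  "sigma_porous_in M P \<longleftrightarrow> (\<exists>\<P>. countable \<P> \<and> (\<forall>A\<in>\<P>. porous_in M A) \<and> P = \<Union>\<P>)"

(* Why the theorem assumes "closed B": in the plane let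
     B = {(x, 1 - |x| - x^2) : 0 < |x| <= 1/2}
   and let the dual unit ball be the closed convex hull of B and -B.  Then B is norming and
   satisfies the separation condition, but every vector close to (0,1) attains its norm on
   the closure of B only at (0,1), which is not in B.  With W = R, both the residuality
   statement and the Bishop-Phelps-Bollobas statement fail.
   Why both spaces are assumed nonzero: for W = 0 and dim Y >= 2 the zero operator does not
   attain its norm strongly, and the complement of the empty set is not sigma-porous in the
   one-point space; for Y = 0 the set B is empty. *)

end

theory Submission
  imports Defs
begin

text \<open>Since \<open>B\<close> is norming, the norm of an operator \<open>R\<close> into \<open>Y\<close> is the supremum over \<open>B\<close> of
  \<open>norm (blinfun_adjoint R f)\<close>, so everything is a question about maximising this function on \<open>B\<close>.
  Because \<open>B\<close> is closed in a complete space, the maximum is strong as soon as the slices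
  \<open>{g \<in> B. norm (blinfun_adjoint R g) > norm R - d}\<close> become arbitrarily small
  (\<open>attains_strongly_norm_on_if_small_slices\<close>).

  Slices are made small by a rank-one perturbation. Take \<open>f \<in> B\<close> with \<open>norm (blinfun_adjoint R f)\<close>
  close to \<open>norm R\<close>, the vector \<open>y\<close> that separates \<open>f\<close> from the functionals at distance at least \<open>e\<close>,
  and a unit functional \<open>u\<close> in the direction of \<open>blinfun_adjoint R f\<close>. Adding the operator
  \<open>w \<mapsto> l * u w * y\<close> increases the value at \<open>f\<close> by exactly \<open>l * f y\<close>, and the value at a far \<open>g\<close> by at
  most \<open>l * \<bar>g y\<bar> \<le> l * (f y - c)\<close>. This creates a gap of nearly \<open>l * c\<close> between \<open>f\<close> and all far
  functionals (\<open>perturbation_with_gap\<close>). The values are 1-Lipschitz in the operator, so the gap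
  persists on a ball whose radius is a fixed fraction of \<open>l\<close>: the operators with large slices form a
  porous set (\<open>porous_large_slices\<close>), and a sequence of values of \<open>e\<close> gives \<open>\<sigma>\<close>-porosity. When
  \<open>blinfun_adjoint R f = 0\<close> any unit functional serves as \<open>u\<close>; its existence is the one place where a
  Hahn--Banach argument enters (\<open>exists_unit_functional\<close>).

  For the Bishop--Phelps--Bollobas statement, the same perturbation is applied to \<open>T\<close> and \<open>f\<close>. By the
  Baire category theorem the perturbed operator is a limit of operators that attain their norm on \<open>B\<close>;
  for a sufficiently good approximation, the gap forbids the maximum point to be far from \<open>f\<close>.
  Normalising the approximation gives the required operator
  (\<open>Bishop_Phelps_Bollobas_of_dense\<close>).\<close>

section \<open>Norming functionals\<close>

definition sublinear :: "('a::real_vector \<Rightarrow> real) \<Rightarrow> bool" where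
  "sublinear q \<longleftrightarrow> (\<forall>x y. q (x + y) \<le> q x + q y) \<and> (\<forall>t\<ge>0. \<forall>x. q (t *\<^sub>R x) = t * q x)"

lemma sublinearI:
  assumes add: "\<And>x y. q (x + y) \<le> q x + q y"
    and scale: "\<And>t x. t > 0 \<Longrightarrow> q (t *\<^sub>R x) \<le> t * q x"
    and zero: "q 0 = 0"
  shows "sublinear q"
proof -
  have "q (t *\<^sub>R x) = t * q x" if "t > 0" for t x
  proof (rule antisym)
    have "q x \<le> (1 / t) * q (t *\<^sub>R x)"
      using scale[of "1 / t" "t *\<^sub>R x"] that by simp
    then show "t * q x \<le> q (t *\<^sub>R x)"
      using that by (simp add: field_simps)
  qed (use scale that in blast)
  then show ?thesis
    using add zero unfolding sublinear_def by (metis less_eq_real_def mult_zero_left scaleR_zero_left)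
qed

lemma sublinear_zero: "sublinear q \<Longrightarrow> q 0 = 0"
  unfolding sublinear_def by (metis mult_zero_left order_refl scaleR_zero_left)

lemma sublinear_minus: "sublinear q \<Longrightarrow> - q (- x) \<le> q x"
proof -
  assume q: "sublinear q"
  then have "q (x + - x) \<le> q x + q (- x)" unfolding sublinear_def by blast
  then show ?thesis using sublinear_zero[OF q] by simp
qed

text \<open>For sublinear \<open>q\<close>, this is the greatest sublinear minorant \<open>r\<close> of \<open>q\<close> with \<open>r (- a) \<le> - q a\<close>:
  such an \<open>r\<close> satisfies \<open>r x \<le> r (x + t *\<^sub>R a) + t * r (- a)\<close> for \<open>t \<ge> 0\<close> and hence lies below each
  term of the infimum.\<close>

definition lowered :: "('a::real_vector \<Rightarrow> real) \<Rightarrow> 'a \<Rightarrow> 'a \<Rightarrow> real" where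
  "lowered q a x = (INF t\<in>{0..}. q (x + t *\<^sub>R a) - t * q a)"

lemma lowered_lower:
  assumes "sublinear q" "t \<ge> 0"
  shows "lowered q a x \<le> q (x + t *\<^sub>R a) - t * q a"
  unfolding lowered_def
proof (rule cINF_lower)
  show "bdd_below ((\<lambda>t. q (x + t *\<^sub>R a) - t * q a) ` {0..})"
  proof (rule bdd_belowI2)
    fix t :: real assume "t \<in> {0..}"
    then have "t * q a = q ((x + t *\<^sub>R a) + (- x))"
      using assms(1) by (simp add: sublinear_def)
    also have "\<dots> \<le> q (x + t *\<^sub>R a) + q (- x)"
      using assms(1) by (simp only: sublinear_def)
    finally show "- q (- x) \<le> q (x + t *\<^sub>R a) - t * q a" by simp
  qed
qed (use assms in simp)

lemma lowered_greatest:
  assumes "\<And>t. t \<ge> 0 \<Longrightarrow> c \<le> q (x + t *\<^sub>R a) - t * q a"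
  shows "c \<le> lowered q a x"
  unfolding lowered_def by (rule cINF_greatest) (use assms in auto)

lemma lowered_le: "sublinear q \<Longrightarrow> lowered q a x \<le> q x"
  using lowered_lower[of q 0 a x] by simp

lemma lowered_uminus: "sublinear q \<Longrightarrow> lowered q a (- a) \<le> - q a"
  using lowered_lower[of q 1 a "- a"] sublinear_zero[of q] by simp

lemma sublinear_lowered:
  assumes q: "sublinear q"
  shows "sublinear (lowered q a)"
proof (rule sublinearI)
  fix x y
  have "lowered q a (x + y) \<le> (q (x + s *\<^sub>R a) - s * q a) + (q (y + t *\<^sub>R a) - t * q a)"
    if "s \<ge> 0" "t \<ge> 0" for s t
  proof -
    have "lowered q a (x + y) \<le> q ((x + s *\<^sub>R a) + (y + t *\<^sub>R a)) - (s + t) * q a"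
      using lowered_lower[OF q, of "s + t" a "x + y"] that by (simp add: algebra_simps)
    also have "\<dots> \<le> q (x + s *\<^sub>R a) + q (y + t *\<^sub>R a) - (s + t) * q a"
      using q by (simp only: sublinear_def diff_right_mono)
    finally show ?thesis by (simp add: algebra_simps)
  qed
  then have "lowered q a (x + y) - (q (x + s *\<^sub>R a) - s * q a) \<le> lowered q a y" if "s \<ge> 0" for s
    using that by (intro lowered_greatest) (simp only: diff_le_eq add.commute)
  then have "lowered q a (x + y) - lowered q a y \<le> lowered q a x"
    by (intro lowered_greatest) (simp only: diff_le_eq add.commute)
  then show "lowered q a (x + y) \<le> lowered q a x + lowered q a y" by simp
next
  fix t :: real and x
  assume t: "t > 0"
  have "lowered q a (t *\<^sub>R x) / t \<le> q (x + s *\<^sub>R a) - s * q a" if "s \<ge> 0" for s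
  proof -
    have "lowered q a (t *\<^sub>R x) \<le> q (t *\<^sub>R (x + s *\<^sub>R a)) - (t * s) * q a"
      using lowered_lower[OF q, of "t * s" a "t *\<^sub>R x"] that t by (simp add: algebra_simps)
    also have "\<dots> = t * (q (x + s *\<^sub>R a) - s * q a)"
    proof -
      have "q (t *\<^sub>R (x + s *\<^sub>R a)) = t * q (x + s *\<^sub>R a)"
        using q t by (simp only: sublinear_def less_imp_le)
      then show ?thesis by (simp add: right_diff_distrib)
    qed
    finally show ?thesis using t by (simp add: field_simps)
  qed
  then have "lowered q a (t *\<^sub>R x) / t \<le> lowered q a x" by (rule lowered_greatest)
  then show "lowered q a (t *\<^sub>R x) \<le> t * lowered q a x" using t by (simp add: field_simps)
next
  have "0 \<le> lowered q a 0"
    using q by (intro lowered_greatest) (simp add: sublinear_def)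
  then show "lowered q a 0 = 0"
    using lowered_le[OF q, of a 0] sublinear_zero[OF q] by simp
qed

text \<open>Subadditivity of the infimum uses the chain condition: two members of the chain can be replaced
  by the smaller one. The lower bound \<open>- p (- x)\<close> for all sublinear minorants of \<open>p\<close> at \<open>x\<close> keeps the
  infimum meaningful.\<close>

lemma sublinear_INF_chain:
  assumes "C \<noteq> {}" and sub: "\<And>q. q \<in> C \<Longrightarrow> sublinear q \<and> q \<le> p"
    and chain: "\<And>q r. q \<in> C \<Longrightarrow> r \<in> C \<Longrightarrow> q \<le> r \<or> r \<le> q"
  shows "sublinear (\<lambda>x. INF q\<in>C. q x)" and "\<And>q. q \<in> C \<Longrightarrow> (\<lambda>x. INF q\<in>C. q x) \<le> q"
proof -
  define u where "u x = (INF q\<in>C. q x)" for x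
  have lower: "u x \<le> q x" if "q \<in> C" for q x
    unfolding u_def
  proof (rule cINF_lower[OF _ that], rule bdd_belowI2)
    fix r assume "r \<in> C"
    then have "- p (- x) \<le> - r (- x)" "- r (- x) \<le> r x"
      using sub sublinear_minus by (auto simp: le_fun_def)
    then show "- p (- x) \<le> r x" by linarith
  qed
  have greatest: "c \<le> u x" if "\<And>q. q \<in> C \<Longrightarrow> c \<le> q x" for c x
    unfolding u_def by (rule cINF_greatest) (use assms(1) that in auto)
  show "\<And>q. q \<in> C \<Longrightarrow> (\<lambda>x. INF q\<in>C. q x) \<le> q"
    using lower by (simp add: le_fun_def u_def)
  have "sublinear u"
  proof (rule sublinearI)
    fix x y
    have "u (x + y) \<le> q x + r y" if "q \<in> C" "r \<in> C" for q r
    proof -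
      obtain s where s: "s \<in> C" "s \<le> q" "s \<le> r"
        using chain[OF \<open>q \<in> C\<close> \<open>r \<in> C\<close>] \<open>q \<in> C\<close> \<open>r \<in> C\<close> by auto
      have "u (x + y) \<le> s (x + y)" using lower s by blast
      also have "\<dots> \<le> s x + s y" using sub s by (simp add: sublinear_def)
      also have "\<dots> \<le> q x + r y" using s by (simp add: le_fun_def add_mono)
      finally show ?thesis .
    qed
    then have "u (x + y) - q x \<le> u y" if "q \<in> C" for q
      using that by (intro greatest) (smt (verit))
    then have "u (x + y) - u y \<le> u x"
      by (intro greatest) (smt (verit))
    then show "u (x + y) \<le> u x + u y" by simp
  next
    fix t :: real and x assume t: "t > 0"
    have "u (t *\<^sub>R x) / t \<le> u x"
    proof (rule greatest)
      fix q assume "q \<in> C"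
      then have "u (t *\<^sub>R x) \<le> t * q x"
        using lower[of q "t *\<^sub>R x"] sub t by (simp add: sublinear_def)
      then show "u (t *\<^sub>R x) / t \<le> q x" using t by (simp add: field_simps)
    qed
    then show "u (t *\<^sub>R x) \<le> t * u x" using t by (simp add: field_simps)
  next
    have "q 0 = 0" if "q \<in> C" for q using sub sublinear_zero that by blast
    then have "u 0 = (INF q\<in>C. 0)" unfolding u_def by (intro INF_cong) auto
    then show "u 0 = 0" using assms(1) by simp
  qed
  then show "sublinear (\<lambda>x. INF q\<in>C. q x)" by (simp add: u_def[abs_def])
qed

text \<open>A form of the Hahn--Banach theorem. A minimal sublinear minorant \<open>q\<close> exists by Zorn's lemma;
  minimality gives \<open>lowered q a = q\<close> for every \<open>a\<close>, hence \<open>q (- a) = - q a\<close>, and an odd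
  sublinear function is linear.\<close>

theorem linear_minorant_of_sublinear:
  assumes p: "sublinear p"
  shows "\<exists>q. linear q \<and> q \<le> p"
proof -
  define A where "A = {q. sublinear q \<and> q \<le> p}"
  have "\<exists>m\<in>A. \<forall>q\<in>A. q \<le> m \<longrightarrow> q = m"
  proof (rule predicate_Zorn)
    show "partial_order_on A (relation_of (\<lambda>q r. r \<le> q) A)"
      by (rule partial_order_on_relation_ofI) auto
  next
    fix C assume C: "C \<in> Chains (relation_of (\<lambda>q r. r \<le> q) A)"
    then have CA: "C \<subseteq> A" by (rule Chains_relation_of)
    show "\<exists>u\<in>A. \<forall>q\<in>C. u \<le> q"
    proof (cases "C = {}")
      case True
      then show ?thesis using p unfolding A_def by blast
    next
      case False
      have sub: "sublinear q \<and> q \<le> p" if "q \<in> C" for q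
        using CA that by (auto simp: A_def)
      have chain: "q \<le> r \<or> r \<le> q" if "q \<in> C" "r \<in> C" for q r
        using C that by (auto simp: Chains_def relation_of_def)
      note u = sublinear_INF_chain[OF False sub chain]
      obtain q where "q \<in> C" using False by blast
      then have "(\<lambda>x. INF q\<in>C. q x) \<le> p" using u(2)[of q] sub[of q] by (meson order_trans)
      then show ?thesis using u by (auto simp: A_def)
    qed
  qed
  then obtain q where q: "sublinear q" "q \<le> p"
    and minimal: "\<And>r. sublinear r \<Longrightarrow> r \<le> p \<Longrightarrow> r \<le> q \<Longrightarrow> r = q"
    unfolding A_def by blast
  have odd: "q (- a) = - q a" for a
  proof -
    have "lowered q a \<le> q" using lowered_le[OF q(1)] by (simp add: le_fun_def)
    then have "lowered q a = q"
      using minimal sublinear_lowered[OF q(1)] q(2) by (meson order_trans)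
    then have "q (- a) \<le> - q a" using lowered_uminus[OF q(1), of a] by simp
    then show ?thesis using sublinear_minus[OF q(1), of "- a"] by simp
  qed
  have "linear q"
  proof (rule linearI)
    fix x y
    \<comment> \<open>oddness turns subadditivity at the negatives into superadditivity\<close>
    have "q (- x + - y) \<le> q (- x) + q (- y)" using q(1) unfolding sublinear_def by blast
    then have "q (- (x + y)) \<le> - q x - q y" using odd by simp
    then have "q x + q y \<le> q (x + y)" using odd[of "x + y"] by simp
    moreover have "q (x + y) \<le> q x + q y" using q(1) by (simp add: sublinear_def)
    ultimately show "q (x + y) = q x + q y" by simp
  next
    fix t :: real and x
    show "q (t *\<^sub>R x) = t *\<^sub>R q x"
    proof (cases "t \<ge> 0")
      case True
      then show ?thesis using q(1) by (simp add: sublinear_def)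
    next
      case False
      then have "q ((- t) *\<^sub>R x) = (- t) * q x"
        using q(1) unfolding sublinear_def by (meson neg_0_le_iff_le linear)
      then show ?thesis using odd[of "t *\<^sub>R x"] by simp
    qed
  qed
  then show ?thesis using q(2) by blast
qed

text \<open>A linear minorant of the norm could vanish. Lowering the norm along \<open>w\<close> first forces the
  value \<open>norm w\<close> at \<open>w\<close>.\<close>

lemma exists_unit_functional:
  fixes w :: "'w::real_normed_vector"
  assumes "w \<noteq> 0"
  shows "\<exists>u :: 'w \<Rightarrow>\<^sub>L real. norm u = 1"
proof -
  have norm: "sublinear (norm :: 'w \<Rightarrow> real)"
    by (simp add: sublinear_def norm_triangle_ineq)
  obtain q where q: "linear q" "q \<le> lowered norm w"
    using linear_minorant_of_sublinear[OF sublinear_lowered[OF norm]] by blast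
  interpret q: linear q by (rule q(1))
  have le: "q x \<le> norm x" for x
    using q(2) lowered_le[OF norm, of w x] by (auto simp: le_fun_def intro: order_trans)
  have abs: "\<bar>q x\<bar> \<le> norm x" for x
    using le[of x] le[of "- x"] by (simp add: q.neg abs_le_iff)
  then have bl: "bounded_linear q"
    by (intro bounded_linear_intro[of q 1]) (auto simp: q.add q.scale)
  have "q (- w) \<le> - norm w"
    using q(2) lowered_uminus[OF norm, of w] by (auto simp: le_fun_def intro: order_trans)
  then have "norm w \<le> \<bar>q w\<bar>" by (simp add: q.neg)
  then have "norm (Blinfun q) = 1"
    using bl abs assms
    by (intro norm_blinfun_eqI[where x = w]) (auto simp: bounded_linear_Blinfun_apply)
  then show ?thesis by blast
qed

section \<open>Porosity and density\<close>

lemma porous_in_subset: "porous_in M P \<Longrightarrow> Q \<subseteq> P \<Longrightarrow> porous_in M Q"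
  unfolding porous_in_def by (meson Diff_mono Int_mono order_refl order_trans)

text \<open>A porous set has nowhere dense closure in \<open>M\<close>, because the balls of \<open>M\<close> that miss it avoid
  its closure at their centres; the Baire category theorem does the rest.\<close>

theorem dense_complement_of_sigma_porous:
  fixes M :: "'a::{metric_space, complete_space} set"
  assumes "closed M" and P: "sigma_porous_in M P" and x: "x \<in> M" and e: "e > 0"
  shows "\<exists>y\<in>M - P. dist y x < e"
proof -
  obtain \<P> where \<P>: "countable \<P>" "\<And>A. A \<in> \<P> \<Longrightarrow> porous_in M A" "P = \<Union>\<P>"
    using P unfolding sigma_porous_in_def by blast
  define U where "U A = M - closure A" for A
  have "top_of_set M closure_of (\<Inter>(U ` \<P>)) = topspace (top_of_set M)"
  proof (rule Baire_category)
    have "completely_metrizable_space (top_of_set M)"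
      using assms(1) by (intro completely_metrizable_space_closedin completely_metrizable_space_euclidean) auto
    then show "completely_metrizable_space (top_of_set M)
      \<or> locally_compact_space (top_of_set M) \<and> regular_space (top_of_set M)" ..
  next
    show "countable (U ` \<P>)" using \<P>(1) by simp
  next
    fix T assume "T \<in> U ` \<P>"
    then obtain A where A: "A \<in> \<P>" "T = U A" by blast
    then obtain l0 r0 where AM: "A \<subseteq> M" and l0: "0 < l0" and r0: "0 < r0"
      and hole: "\<And>x r. x \<in> M \<Longrightarrow> 0 < r \<Longrightarrow> r \<le> r0 \<Longrightarrow>
            \<exists>y\<in>M. ball y (l0 * r) \<inter> M \<subseteq> (ball x r \<inter> M) \<inter> (M - A)"
      using \<P>(2)[of A] unfolding porous_in_def by blast
    have "openin (top_of_set M) T"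
      unfolding A U_def Diff_eq by (intro openin_open_Int) (simp add: open_Compl)
    moreover have "M \<subseteq> closure T"
    proof
      fix z assume z: "z \<in> M"
      show "z \<in> closure T"
        unfolding closure_approachable
      proof (intro allI impI)
        fix d :: real assume d: "d > 0"
        define r where "r = min d r0"
        have r: "0 < r" "r \<le> r0" "r \<le> d" using d r0 by (auto simp: r_def)
        obtain y where y: "y \<in> M" and sub: "ball y (l0 * r) \<inter> M \<subseteq> (ball z r \<inter> M) \<inter> (M - A)"
          using hole[OF z r(1,2)] by blast
        have pos: "l0 * r > 0" using l0 r by simp
        have "y \<notin> closure A"
        proof
          assume "y \<in> closure A"
          then obtain a where "a \<in> A" "dist a y < l0 * r"
            using pos unfolding closure_approachable by blast
          then have "a \<in> ball y (l0 * r) \<inter> M" using AM by (auto simp: dist_commute)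
          then show False using sub \<open>a \<in> A\<close> by blast
        qed
        moreover have "y \<in> ball z r"
        proof -
          have "y \<in> ball y (l0 * r) \<inter> M" using y pos by simp
          then show ?thesis using sub by blast
        qed
        ultimately show "\<exists>y\<in>T. dist y z < d"
          using y r(3) unfolding A U_def by (intro bexI[of _ y]) (auto simp: dist_commute)
      qed
    qed
    ultimately show "openin (top_of_set M) T \<and> top_of_set M closure_of T = topspace (top_of_set M)"
      by (auto simp: closure_of_subtopology A U_def Int_absorb1)
  qed
  then have "x \<in> top_of_set M closure_of (\<Inter>(U ` \<P>))" using x by simp
  then have "x \<in> closure (M \<inter> \<Inter>(U ` \<P>))" by (auto simp: closure_of_subtopology)
  then obtain y where y: "y \<in> M" "y \<in> \<Inter>(U ` \<P>)" "dist y x < e"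
    using e unfolding closure_approachable by blast
  have "y \<notin> P" using y(2) closure_subset unfolding \<P>(3) U_def by blast
  then show ?thesis using y by blast
qed

section \<open>Strong maxima and shrinking slices\<close>

definition small_slice :: "('a::real_normed_vector \<Rightarrow>\<^sub>L 'b::real_normed_vector) \<Rightarrow> 'a set \<Rightarrow> real \<Rightarrow> bool" where
  "small_slice R B e \<longleftrightarrow>
     (\<exists>f\<in>B. \<exists>d>0. \<forall>g\<in>B. norm R - d < norm (R g) \<longrightarrow> norm (g - f) < e)"

text \<open>Maximising sequences are Cauchy when the slices are small, and any two of them are asymptotic.
  Closedness of \<open>B\<close> puts their common limit, the strong maximum point, in \<open>B\<close>.\<close>

lemma attains_strongly_norm_on_if_small_slices:
  fixes R :: "'a::banach \<Rightarrow>\<^sub>L 'b::real_normed_vector"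
  assumes "closed B" "B \<noteq> {}" and bdd: "bdd_above ((\<lambda>f. norm (R f)) ` B)"
    and sup: "norm R = (SUP f\<in>B. norm (R f))"
    and small: "\<And>e. e > 0 \<Longrightarrow> small_slice R B e"
  shows "attains_strongly_norm_on R B"
proof -
  have close: "\<exists>d>0. \<forall>g\<in>B. \<forall>h\<in>B. norm R - d < norm (R g) \<longrightarrow> norm R - d < norm (R h) \<longrightarrow> norm (g - h) < e"
    if "e > 0" for e
  proof -
    obtain f d where d: "d > 0" and fd: "\<And>g. g \<in> B \<Longrightarrow> norm R - d < norm (R g) \<Longrightarrow> norm (g - f) < e / 2"
      using small[OF half_gt_zero[OF \<open>e > 0\<close>]] unfolding small_slice_def by blast
    have "norm (g - h) < e" if "g \<in> B" "h \<in> B" "norm R - d < norm (R g)" "norm R - d < norm (R h)" for g h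
      using fd[of g] fd[of h] that norm_triangle_ineq4[of "g - f" "h - f"] by simp
    then show ?thesis using d by blast
  qed
  have "\<exists>h\<in>B. norm R - 1 / real (Suc n) < norm (R h)" for n
    using less_cSUP_iff[OF assms(2) bdd, of "norm R - 1 / real (Suc n)"] sup by auto
  then obtain h where h: "\<And>n. h n \<in> B" "\<And>n. norm R - 1 / real (Suc n) < norm (R (h n))" by metis
  have h_near: "\<forall>\<^sub>F n in sequentially. norm R - d < norm (R (h n))" if "d > 0" for d
  proof -
    obtain N where "1 / real (Suc N) < d" using nat_approx_posE[OF \<open>d > 0\<close>] by blast
    moreover have "1 / real (Suc n) \<le> 1 / real (Suc N)" if "n \<ge> N" for n using that by (simp add: frac_le)
    ultimately have "norm R - d < norm (R (h n))" if "n \<ge> N" for n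
      using h(2)[of n] that by (smt (verit))
    then show ?thesis unfolding eventually_sequentially by blast
  qed
  have "Cauchy h"
    unfolding Cauchy_def
  proof (intro allI impI)
    fix e :: real assume "e > 0"
    then obtain d where d: "d > 0"
      "\<forall>g\<in>B. \<forall>h\<in>B. norm R - d < norm (R g) \<longrightarrow> norm R - d < norm (R h) \<longrightarrow> norm (g - h) < e"
      using close by blast
    obtain N where "\<forall>n\<ge>N. norm R - d < norm (R (h n))"
      using h_near[OF d(1)] unfolding eventually_sequentially by blast
    then have "\<forall>m\<ge>N. \<forall>n\<ge>N. dist (h m) (h n) < e"
      using d(2) h(1) unfolding dist_norm by blast
    then show "\<exists>M. \<forall>m\<ge>M. \<forall>n\<ge>M. dist (h m) (h n) < e" ..
  qed
  then obtain f0 where f0: "h \<longlonglongrightarrow> f0" using Cauchy_convergent_iff convergent_def by blast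
  have f0B: "f0 \<in> B" using closed_sequentially[OF assms(1) _ f0] h(1) by blast
  have lim: "(\<lambda>n. norm (R (h n))) \<longlonglongrightarrow> norm (R f0)"
    by (intro tendsto_norm blinfun.tendsto tendsto_const f0)
  have "norm (R f0) \<le> norm R" using cSUP_upper[OF f0B bdd] sup by simp
  moreover have "norm R \<le> norm (R f0)"
  proof (rule field_le_epsilon)
    fix d :: real assume "d > 0"
    have "norm R - d \<le> norm (R f0)"
      by (rule tendsto_lowerbound[OF lim]) (use h_near[OF \<open>d > 0\<close>] in \<open>auto elim: eventually_mono\<close>)
    then show "norm R \<le> norm (R f0) + d" by simp
  qed
  ultimately have max: "norm (R f0) = norm R" by simp
  have "(\<lambda>n. norm (f n - f0)) \<longlonglongrightarrow> 0"
    if f: "range f \<subseteq> B" and conv: "(\<lambda>n. norm (R (f n))) \<longlonglongrightarrow> norm (R f0)" for f :: "nat \<Rightarrow> 'a"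
  proof (rule tendstoI)
    fix e :: real assume "e > 0"
    then obtain d where d: "d > 0"
      "\<forall>g\<in>B. \<forall>h\<in>B. norm R - d < norm (R g) \<longrightarrow> norm R - d < norm (R h) \<longrightarrow> norm (g - h) < e"
      using close by blast
    have "\<forall>\<^sub>F n in sequentially. norm R - d < norm (R (f n))"
      using order_tendstoD(1)[OF conv, of "norm R - d"] d(1) max by simp
    then show "\<forall>\<^sub>F n in sequentially. dist (norm (f n - f0)) 0 < e"
    proof (rule eventually_mono)
      fix n assume "norm R - d < norm (R (f n))"
      moreover have "f n \<in> B" "norm R - d < norm (R f0)" using f d(1) max by auto
      ultimately have "norm (f n - f0) < e" using d(2) f0B by blast
      then show "dist (norm (f n - f0)) 0 < e" by simp
    qed
  qed
  then show ?thesis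
    using max sup f0B unfolding attains_strongly_norm_on_def by metis
qed

section \<open>Adjoints and rank-one perturbations\<close>

lemma blinfun_adjoint_add: "blinfun_adjoint S + blinfun_adjoint T = blinfun_adjoint (S + T)"
  by (intro blinfun_eqI) (simp add: blinfun.add_left blinfun.add_right)

lemma blinfun_adjoint_diff: "blinfun_adjoint S - blinfun_adjoint T = blinfun_adjoint (S - T)"
  by (intro blinfun_eqI) (simp add: blinfun.diff_left blinfun.diff_right)

lemma norm_blinfun_adjoint_le: "norm (blinfun_adjoint T) \<le> norm T"
  by (rule norm_blinfun_bound) (auto simp: norm_blinfun_compose mult.commute[of "norm T"])

lemma norm_blinfun_adjoint_apply_le:
  "norm f = 1 \<Longrightarrow> norm (blinfun_adjoint T f) \<le> norm T"
  using norm_blinfun_compose[of f T] by simp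

lemma norm_blinfun_adjoint_close:
  assumes "norm f = 1"
  shows "\<bar>norm (blinfun_adjoint S f) - norm (blinfun_adjoint T f)\<bar> \<le> norm (S - T)"
proof -
  have "\<bar>norm (blinfun_adjoint S f) - norm (blinfun_adjoint T f)\<bar>
      \<le> norm (blinfun_adjoint S f - blinfun_adjoint T f)" by (rule norm_triangle_ineq3)
  also have "\<dots> = norm (blinfun_adjoint (S - T) f)"
    by (simp only: blinfun.diff_left[symmetric] blinfun_adjoint_diff)
  finally show ?thesis using norm_blinfun_adjoint_apply_le[OF assms, of "S - T"] by linarith
qed

definition norming :: "('y::real_normed_vector \<Rightarrow>\<^sub>L real) set \<Rightarrow> bool" where
  "norming B \<longleftrightarrow> B \<noteq> {} \<and> B \<subseteq> sphere 0 1 \<and> (\<forall>y. norm y = (SUP f\<in>B. \<bar>blinfun_apply f y\<bar>))"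

lemma norming_unit: "norming B \<Longrightarrow> f \<in> B \<Longrightarrow> norm f = 1"
  unfolding norming_def by auto

lemma norming_bdd_above:
  assumes "norming B"
  shows "bdd_above ((\<lambda>f. norm (blinfun_adjoint R f)) ` B)"
  using norm_blinfun_adjoint_apply_le[OF norming_unit[OF assms]] by (intro bdd_aboveI2)

lemma norm_eq_SUP_adjoint:
  fixes R :: "'w::real_normed_vector \<Rightarrow>\<^sub>L 'y::real_normed_vector" and B :: "('y \<Rightarrow>\<^sub>L real) set"
  assumes B: "norming B"
  shows "norm R = (SUP f\<in>B. norm (blinfun_adjoint R f))" (is "_ = ?s")
proof (rule antisym)
  have ne: "B \<noteq> {}" using B by (simp add: norming_def)
  have upper: "norm (blinfun_adjoint R f) \<le> ?s" if "f \<in> B" for f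
    using that norming_bdd_above[OF B] by (rule cSUP_upper)
  show "norm R \<le> ?s"
  proof (rule norm_blinfun_bound)
    show "0 \<le> ?s" using ne upper norm_ge_zero order_trans by (metis ex_in_conv)
    fix w
    have "norm (R w) = (SUP f\<in>B. \<bar>blinfun_apply f (R w)\<bar>)" using B by (simp add: norming_def)
    also have "\<dots> \<le> ?s * norm w"
    proof (rule cSUP_least[OF ne])
      fix f assume f: "f \<in> B"
      have "\<bar>blinfun_apply f (R w)\<bar> \<le> norm (blinfun_adjoint R f) * norm w"
        using norm_blinfun[of "blinfun_adjoint R f" w] by simp
      also have "\<dots> \<le> ?s * norm w" using upper[OF f] by (rule mult_right_mono) simp
      finally show "\<bar>blinfun_apply f (R w)\<bar> \<le> ?s * norm w" .
    qed
    finally show "norm (R w) \<le> ?s * norm w" .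
  qed
  show "?s \<le> norm R"
    using norm_blinfun_adjoint_apply_le[OF norming_unit[OF B]] by (rule cSUP_least[OF ne])
qed

lemma norm_blinfun_adjoint_eq:
  fixes R :: "'w::real_normed_vector \<Rightarrow>\<^sub>L 'y::real_normed_vector" and B :: "('y \<Rightarrow>\<^sub>L real) set"
  assumes B: "norming B"
  shows "norm (blinfun_adjoint R) = norm R"
proof (rule antisym[OF norm_blinfun_adjoint_le])
  have "norm (blinfun_adjoint R f) \<le> norm (blinfun_adjoint R)" if "f \<in> B" for f
    using norm_blinfun[of "blinfun_adjoint R" f] norming_unit[OF B that] by simp
  then show "norm R \<le> norm (blinfun_adjoint R)"
    unfolding norm_eq_SUP_adjoint[OF B, of R] using B by (intro cSUP_least) (auto simp: norming_def)
qed

text \<open>A rank-one perturbation raises \<open>norm (blinfun_adjoint R f)\<close> by the full amount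
  \<open>l * f y\<close> when its functional is aligned with \<open>blinfun_adjoint R f\<close>. If the latter vanishes, every
  unit functional is aligned with it.\<close>

lemma aligned_rank_one_perturbation:
  fixes R :: "'w::real_normed_vector \<Rightarrow>\<^sub>L 'y::real_normed_vector"
  assumes W: "\<exists>w::'w. w \<noteq> 0" and y: "norm y \<le> 1" "0 \<le> blinfun_apply f y" and l: "0 \<le> l"
  obtains K :: "'w \<Rightarrow>\<^sub>L 'y" where "finite_rank K" "norm K \<le> l"
    "norm (blinfun_adjoint (R + K) f) = norm (blinfun_adjoint R f) + l * f y"
    "\<And>g. norm (blinfun_adjoint (R + K) g) \<le> norm (blinfun_adjoint R g) + l * \<bar>g y\<bar>"
proof -
  let ?v = "f o\<^sub>L R"
  obtain u :: "'w \<Rightarrow>\<^sub>L real" where u: "norm u = 1" "?v = norm ?v *\<^sub>R u"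
  proof (cases "?v = 0")
    case True
    obtain u :: "'w \<Rightarrow>\<^sub>L real" where "norm u = 1" using W exists_unit_functional by blast
    moreover have "?v = norm ?v *\<^sub>R u" using True by simp
    ultimately show ?thesis by (rule that)
  next
    case False
    then have "norm (sgn ?v) = 1" "?v = norm ?v *\<^sub>R sgn ?v"
      by (simp_all only: norm_sgn sgn_div_norm) simp_all
    then show ?thesis by (rule that)
  qed
  define K where "K = blinfun_scaleR_left y o\<^sub>L (l *\<^sub>R u)"
  have adj: "blinfun_adjoint (R + K) g = blinfun_adjoint R g + (l * g y) *\<^sub>R u" for g
    by (intro blinfun_eqI)
      (simp add: K_def blinfun.add_left blinfun.add_right blinfun.scaleR_right blinfun.scaleR_left)
  show ?thesis
  proof (rule that[of K])
    show "finite_rank K"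
      unfolding finite_rank_def K_def
      by (intro exI[of _ "{y}"]) (auto simp: blinfun.scaleR_left span_base span_scale)
    show "norm K \<le> l"
    proof (rule norm_blinfun_bound[OF l])
      fix w
      have "norm (K w) = l * \<bar>u w\<bar> * norm y" using l by (simp add: K_def blinfun.scaleR_left abs_mult)
      also have "\<dots> \<le> l * norm w * 1"
        using norm_blinfun[of u w] u y l by (intro mult_mono mult_left_mono) auto
      finally show "norm (K w) \<le> l * norm w" by simp
    qed
    have "blinfun_adjoint (R + K) f = (norm ?v + l * f y) *\<^sub>R u"
      using u(2) unfolding adj by (simp add: scaleR_left_distrib)
    then show "norm (blinfun_adjoint (R + K) f) = norm (blinfun_adjoint R f) + l * f y"
      using u(1) y(2) l by simp
    show "norm (blinfun_adjoint (R + K) g) \<le> norm (blinfun_adjoint R g) + l * \<bar>g y\<bar>" for g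
      unfolding adj by (rule order_trans[OF norm_triangle_ineq]) (use u l in \<open>simp add: abs_mult\<close>)
  qed
qed

section \<open>Separated norming sets\<close>

definition separated :: "('y::real_normed_vector \<Rightarrow>\<^sub>L real) set \<Rightarrow> real \<Rightarrow> real \<Rightarrow> bool" where
  "separated B e c \<longleftrightarrow> (\<forall>f\<in>B. \<exists>y. norm y \<le> 1 \<and> 0 \<le> blinfun_apply f y \<and>
     (\<forall>g\<in>B. e \<le> norm (g - f) \<longrightarrow> \<bar>blinfun_apply g y\<bar> + c \<le> blinfun_apply f y))"

text \<open>The sign condition in \<open>separated\<close> costs nothing: a negative \<open>f y\<close> is incompatible with the
  existence of any \<open>g\<close> far from \<open>f\<close>, and then \<open>y\<close> may be replaced by \<open>- y\<close>.\<close>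

lemma separated_with_small_constant:
  assumes c: "c > 0" and sep: "\<forall>f\<in>B. \<exists>y\<in>cball 0 1. \<forall>g\<in>B.
            norm (g - f) \<ge> e \<longrightarrow> blinfun_apply f y - c \<ge> \<bar>blinfun_apply g y\<bar>"
  shows "\<exists>c>0. c \<le> 1 \<and> separated B e c"
proof (intro exI conjI)
  show "min c 1 > 0" "min c 1 \<le> 1" using c by auto
  show "separated B e (min c 1)"
    unfolding separated_def
  proof
    fix f assume "f \<in> B"
    then obtain y where y: "norm y \<le> 1"
      "\<And>g. g \<in> B \<Longrightarrow> e \<le> norm (g - f) \<Longrightarrow> \<bar>blinfun_apply g y\<bar> \<le> blinfun_apply f y - c"
      using sep by force
    show "\<exists>y. norm y \<le> 1 \<and> 0 \<le> blinfun_apply f y \<and>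
      (\<forall>g\<in>B. e \<le> norm (g - f) \<longrightarrow> \<bar>blinfun_apply g y\<bar> + min c 1 \<le> blinfun_apply f y)"
    proof (cases "0 \<le> blinfun_apply f y")
      case True
      then show ?thesis using y by (intro exI[of _ y]) force
    next
      case False
      then have "\<not> e \<le> norm (g - f)" if "g \<in> B" for g
        using y(2)[OF that] c by auto
      then show ?thesis using y(1) False
        by (intro exI[of _ "- y"]) (auto simp: blinfun.minus_right)
    qed
  qed
qed

text \<open>Aligning \<open>K\<close> with \<open>f\<close> raises the value at \<open>f\<close> by at least \<open>l * c\<close> more than the value at a far
  functional. Once this exceeds the defect \<open>norm R - norm (blinfun_adjoint R f)\<close> of \<open>f\<close>, no far
  functional can come close to maximising for \<open>R + K\<close>. This is the common source of
  porosity and of the quantitative statement.\<close>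

lemma perturbation_with_gap:
  fixes R :: "'w::real_normed_vector \<Rightarrow>\<^sub>L 'y::real_normed_vector"
  assumes W: "\<exists>w::'w. w \<noteq> 0" and B: "norming B" and sep: "separated B e c"
    and f: "f \<in> B" and l: "0 \<le> l"
  obtains K :: "'w \<Rightarrow>\<^sub>L 'y" where "finite_rank K" "norm K \<le> l"
    "\<And>g. g \<in> B \<Longrightarrow> e \<le> norm (g - f) \<Longrightarrow> norm (blinfun_adjoint (R + K) g)
        \<le> norm (blinfun_adjoint (R + K) f) + (norm R - norm (blinfun_adjoint R f)) - l * c"
proof -
  obtain y where y: "norm y \<le> 1" "0 \<le> blinfun_apply f y"
    and far: "\<And>g. g \<in> B \<Longrightarrow> e \<le> norm (g - f) \<Longrightarrow> \<bar>blinfun_apply g y\<bar> + c \<le> blinfun_apply f y"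
    using sep f unfolding separated_def by blast
  obtain K :: "'w \<Rightarrow>\<^sub>L 'y" where K: "finite_rank K" "norm K \<le> l"
    "norm (blinfun_adjoint (R + K) f) = norm (blinfun_adjoint R f) + l * f y"
    "\<And>g. norm (blinfun_adjoint (R + K) g) \<le> norm (blinfun_adjoint R g) + l * \<bar>g y\<bar>"
    by (rule aligned_rank_one_perturbation[OF W y l, of R], rule that)
  show ?thesis
  proof (rule that[OF K(1,2)])
    fix g assume g: "g \<in> B" "e \<le> norm (g - f)"
    have "l * (\<bar>g y\<bar> + c) \<le> l * f y" using far[OF g] l by (rule mult_left_mono)
    moreover have "norm (blinfun_adjoint R g) \<le> norm R"
      using norm_blinfun_adjoint_apply_le norming_unit[OF B g(1)] by blast
    ultimately show "norm (blinfun_adjoint (R + K) g)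
        \<le> norm (blinfun_adjoint (R + K) f) + (norm R - norm (blinfun_adjoint R f)) - l * c"
      using K(3) K(4)[of g] by (simp only: distrib_left)
  qed
qed

text \<open>Around \<open>T\<close>, a hole of radius \<open>c / 16 * r\<close> is centred at \<open>T + K\<close> with \<open>norm K \<le> r / 2\<close>. The gap
  created by \<open>K\<close> is \<open>r * c / 2\<close>; choosing \<open>f\<close> costs \<open>r * c / 8\<close> of it, moving inside the hole costs
  \<open>r * c / 16\<close> at each of the two functionals compared, and the remaining \<open>r * c / 4\<close> leaves room for a
  slice of depth \<open>r * c / 8\<close>.\<close>

lemma porous_large_slices:
  fixes B :: "('y::real_normed_vector \<Rightarrow>\<^sub>L real) set" and \<B> :: "('w::real_normed_vector \<Rightarrow>\<^sub>L 'y) set"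
  assumes W: "\<exists>w::'w. w \<noteq> 0" and B: "norming B"
    and c: "0 < c" "c \<le> 1" and sep: "separated B e c"
    and \<B>: "subspace \<B>" "{F. finite_rank F} \<subseteq> \<B>"
  shows "porous_in \<B> {T \<in> \<B>. \<not> small_slice (blinfun_adjoint (S + T)) B e}" (is "porous_in _ ?P")
  unfolding porous_in_def
proof (intro conjI exI allI ballI impI)
  show "?P \<subseteq> \<B>" by blast
  show "0 < c / 16" "c / 16 \<le> 1" "(0::real) < 1" using c by auto
  fix T r assume T: "T \<in> \<B>" and "0 < r \<and> r \<le> (1::real)"
  then have r: "0 < r" by simp
  define R where "R = S + T"
  have "\<exists>f\<in>B. norm R - r * c / 8 < norm (blinfun_adjoint R f)"
    using less_cSUP_iff[OF _ norming_bdd_above[OF B], of "norm R - r * c / 8" R]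
      norm_eq_SUP_adjoint[OF B, of R] B r c by (simp add: norming_def)
  then obtain f where f: "f \<in> B" "norm R - r * c / 8 < norm (blinfun_adjoint R f)" by blast
  obtain K :: "'w \<Rightarrow>\<^sub>L 'y" where K: "finite_rank K" "norm K \<le> r / 2"
    and gap: "\<And>g. g \<in> B \<Longrightarrow> e \<le> norm (g - f) \<Longrightarrow> norm (blinfun_adjoint (R + K) g)
        \<le> norm (blinfun_adjoint (R + K) f) + (norm R - norm (blinfun_adjoint R f)) - r / 2 * c"
    using perturbation_with_gap[OF W B sep f(1), of "r / 2" R] r by auto
  have rc: "0 < r * c" "r * c \<le> r" using r c by (auto simp: mult_le_cancel_left1)
  show "\<exists>y\<in>\<B>. ball y (c / 16 * r) \<inter> \<B> \<subseteq> ball T r \<inter> \<B> \<inter> (\<B> - ?P)"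
  proof (intro bexI[of _ "T + K"] subsetI)
    show "T + K \<in> \<B>" using T K(1) \<B> by (auto intro: subspace_add)
    fix U assume "U \<in> ball (T + K) (c / 16 * r) \<inter> \<B>"
    then have U: "U \<in> \<B>" "norm (T + K - U) < r * c / 16" by (auto simp: dist_norm mult.commute)
    have "norm (T - U) \<le> norm (T + K - U) + norm K"
      using norm_triangle_ineq4[of "T + K - U" K] by (simp add: algebra_simps)
    then have near: "dist T U < r" using U K(2) rc r unfolding dist_norm by linarith
    have close: "\<bar>norm (blinfun_adjoint (R + K) g) - norm (blinfun_adjoint (S + U) g)\<bar> \<le> r * c / 16"
      if "g \<in> B" for g
    proof -
      have "R + K - (S + U) = T + K - U" by (simp add: R_def)
      then show ?thesis
        using norm_blinfun_adjoint_close[OF norming_unit[OF B that], of "R + K" "S + U"] U(2)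
        by (simp only:)
    qed
    have "norm (g - f) < e"
      if g: "g \<in> B" "norm (blinfun_adjoint (S + U)) - r * c / 8 < norm (blinfun_adjoint (S + U) g)" for g
    proof (rule ccontr)
      assume "\<not> norm (g - f) < e"
      then have "norm (blinfun_adjoint (R + K) g)
        \<le> norm (blinfun_adjoint (R + K) f) + (norm R - norm (blinfun_adjoint R f)) - r / 2 * c"
        using gap g(1) by simp
      moreover have "norm (blinfun_adjoint (S + U) f) \<le> norm (blinfun_adjoint (S + U))"
        using norm_blinfun[of "blinfun_adjoint (S + U)" f] norming_unit[OF B f(1)] by simp
      ultimately show False
        using close[OF f(1)] close[OF g(1)] f(2) g(2) rc(1) by linarith
    qed
    then have "small_slice (blinfun_adjoint (S + U)) B e"
      unfolding small_slice_def using f(1) rc(1) by (intro bexI[of _ f] exI[of _ "r * c / 8"]) auto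
    then show "U \<in> ball T r \<inter> \<B> \<inter> (\<B> - ?P)" using U(1) near by simp
  qed
qed

text \<open>For each \<open>e\<close> in a positive null sequence the operators without a slice of radius \<open>e\<close> form a porous set, and
  off the union of these sets the maximum is strong. Porosity passes to subsets, so the operators
  that do not attain their norm strongly are exactly a \<open>\<sigma>\<close>-porous set.\<close>

lemma sigma_porous_not_strongly_attaining:
  fixes B :: "('y::real_normed_vector \<Rightarrow>\<^sub>L real) set" and \<B> :: "('w::real_normed_vector \<Rightarrow>\<^sub>L 'y) set"
  assumes W: "\<exists>w::'w. w \<noteq> 0" and B: "norming B" "closed B"
    and e0: "e0 > 0" and sep: "\<And>e. 0 < e \<Longrightarrow> e < e0 \<Longrightarrow> \<exists>c>0. c \<le> 1 \<and> separated B e c"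
    and \<B>: "subspace \<B>" "{F. finite_rank F} \<subseteq> \<B>"
  shows "sigma_porous_in \<B> {T \<in> \<B>. \<not> attains_strongly_norm_on (blinfun_adjoint S + blinfun_adjoint T) B}"
    (is "sigma_porous_in _ ?N")
proof -
  \<comment> \<open>separation is only available strictly below \<open>e0\<close>, hence the denominator starts at 2\<close>
  define e where "e n = e0 / real (n + 2)" for n
  define P where "P n = ?N \<inter> {T \<in> \<B>. \<not> small_slice (blinfun_adjoint (S + T)) B (e n)}" for n
  have porous: "porous_in \<B> (P n)" for n
  proof -
    have "0 < e n" "e n < e0" using e0 by (auto simp: e_def field_simps add_pos_nonneg)
    then obtain c where "0 < c" "c \<le> 1" "separated B (e n) c" using sep by blast
    then show ?thesis
      unfolding P_def by (intro porous_in_subset[OF porous_large_slices[OF W B(1) _ _ _ \<B>]]) auto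
  qed
  have "T \<in> (\<Union>n. P n)" if T: "T \<in> ?N" for T
  proof (rule ccontr)
    assume "T \<notin> (\<Union>n. P n)"
    then have small: "small_slice (blinfun_adjoint (S + T)) B (e n)" for n
      using T by (auto simp: P_def)
    have "small_slice (blinfun_adjoint (S + T)) B d" if "d > 0" for d
    proof -
      obtain n where "e0 / d < real n" using reals_Archimedean2 by blast
      then have "e n \<le> d" using e0 that by (simp add: e_def field_simps)
      then show ?thesis using small[of n] unfolding small_slice_def by (meson less_le_trans)
    qed
    then have "attains_strongly_norm_on (blinfun_adjoint (S + T)) B"
      using B norm_eq_SUP_adjoint[OF B(1), of "S + T"]
      unfolding norm_blinfun_adjoint_eq[OF B(1), symmetric]
      by (intro attains_strongly_norm_on_if_small_slices norming_bdd_above) (simp_all only: norming_def simp_thms)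
    then show False using T by (simp add: blinfun_adjoint_add)
  qed
  then have "?N = \<Union>(range P)" by (auto simp: P_def)
  then show ?thesis
    unfolding sigma_porous_in_def using porous by (intro exI[of _ "range P"]) auto
qed

text \<open>An operator that nearly attains its norm at \<open>f\<close> is first perturbed to create a gap between \<open>f\<close>
  and the far functionals, and then approximated by an operator that attains its norm; the gap
  survives the approximation and forces the maximum point to be close to \<open>f\<close>.\<close>

lemma Bishop_Phelps_Bollobas_of_dense:
  fixes B :: "('y::real_normed_vector \<Rightarrow>\<^sub>L real) set" and \<B> :: "('w::real_normed_vector \<Rightarrow>\<^sub>L 'y) set"
  assumes W: "\<exists>w::'w. w \<noteq> 0" and B: "norming B"
    and c: "0 < c" "c \<le> 1" and sep: "separated B d c" and d: "d \<le> e" and e: "0 < e"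
    and \<B>: "subspace \<B>" "{F. finite_rank F} \<subseteq> \<B>"
    and dense: "\<And>T b. T \<in> \<B> \<Longrightarrow> b > 0 \<Longrightarrow>
      \<exists>S\<in>\<B>. norm (S - T) < b \<and> (\<exists>g\<in>B. norm (blinfun_adjoint S g) = norm S)"
  shows "\<exists>\<eta>>0. \<forall>T\<in>\<B>. \<forall>f\<in>B. norm T = 1 \<and> norm (blinfun_adjoint T f) > 1 - \<eta> \<longrightarrow>
    (\<exists>S\<in>\<B>. \<exists>g\<in>B. norm S = 1 \<and> norm (blinfun_adjoint S g) = 1 \<and> norm (g - f) < e \<and> norm (S - T) < e)"
proof -
  \<comment> \<open>a perturbation of size at most \<open>l + l / 4\<close> must stay below 1, so as not to reach 0, and below
    \<open>e / 2\<close>, because normalising may double the distance to \<open>T\<close>\<close>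
  define l where "l = min e 1 / 4"
  have l: "0 < l" "4 * l \<le> e" "4 * l \<le> 1" using e by (auto simp: l_def)
  have lc: "0 < l * c" "l * c \<le> l" using l c by (auto simp: mult_le_cancel_left1)
  show ?thesis
  proof (intro exI[of _ "l * c / 2"] conjI ballI impI)
    show "0 < l * c / 2" using lc by simp
    fix T f assume T: "T \<in> \<B>" and f: "f \<in> B"
      and "norm T = 1 \<and> norm (blinfun_adjoint T f) > 1 - l * c / 2"
    then have T1: "norm T = 1" and Tf: "norm (blinfun_adjoint T f) > 1 - l * c / 2" by auto
    obtain K :: "'w \<Rightarrow>\<^sub>L 'y" where K: "finite_rank K" "norm K \<le> l"
      and gap: "\<And>g. g \<in> B \<Longrightarrow> d \<le> norm (g - f) \<Longrightarrow> norm (blinfun_adjoint (T + K) g)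
        \<le> norm (blinfun_adjoint (T + K) f) + (norm T - norm (blinfun_adjoint T f)) - l * c"
      using perturbation_with_gap[OF W B sep f, of l T] l by auto
    have "T + K \<in> \<B>" using T K(1) \<B> by (auto intro: subspace_add)
    then obtain U g where U: "U \<in> \<B>" "norm (U - (T + K)) < l * c / 4"
      and g: "g \<in> B" "norm (blinfun_adjoint U g) = norm U"
      using dense[of "T + K" "l * c / 4"] lc by auto
    have near: "norm (g - f) < d"
    proof (rule ccontr)
      assume "\<not> norm (g - f) < d"
      then have "norm (blinfun_adjoint (T + K) g)
          \<le> norm (blinfun_adjoint (T + K) f) + (norm T - norm (blinfun_adjoint T f)) - l * c"
        using gap g(1) by simp
      moreover have "norm (blinfun_adjoint U f) \<le> norm (blinfun_adjoint U g)"
        using norm_blinfun_adjoint_apply_le[OF norming_unit[OF B f]] g(2) by simp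
      ultimately show False
        using norm_blinfun_adjoint_close[OF norming_unit[OF B f], of U "T + K"]
          norm_blinfun_adjoint_close[OF norming_unit[OF B g(1)], of U "T + K"] U(2) T1 Tf
        by linarith
    qed
    have UT: "norm (U - T) < 2 * l"
    proof -
      have "norm (U - T) \<le> norm (U - (T + K)) + norm K"
        using norm_triangle_ineq[of "U - (T + K)" K] by simp
      then show ?thesis using U(2) K(2) lc l(1) by linarith
    qed
    have U1: "\<bar>norm U - 1\<bar> \<le> norm (U - T)"
      using norm_triangle_ineq3[of U T] T1 by simp
    then have pos: "norm U > 0" using UT l by linarith
    define V where "V = (1 / norm U) *\<^sub>R U"
    have "V \<in> \<B>" unfolding V_def using \<B>(1) U(1) by (rule subspace_scale)
    moreover have "norm V = 1" using pos by (simp add: V_def)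
    moreover have "norm (blinfun_adjoint V g) = 1"
    proof -
      have "blinfun_adjoint V g = (1 / norm U) *\<^sub>R blinfun_adjoint U g"
        by (intro blinfun_eqI) (simp add: V_def blinfun.scaleR_left blinfun.scaleR_right)
      then show ?thesis using g(2) pos by simp
    qed
    moreover have "norm (V - T) < e"
    proof -
      have "V - U = (1 / norm U - 1) *\<^sub>R U" by (simp add: V_def scaleR_left_diff_distrib)
      then have "norm (V - U) = \<bar>(1 / norm U - 1) * norm U\<bar>" by (simp add: abs_mult)
      also have "\<dots> = \<bar>norm U - 1\<bar>" using pos by (simp add: left_diff_distrib abs_minus_commute)
      finally show ?thesis
        using norm_triangle_ineq[of "V - U" "U - T"] U1 UT l(2) by simp
    qed
    ultimately show "\<exists>S\<in>\<B>. \<exists>g\<in>B. norm S = 1 \<and> norm (blinfun_adjoint S g) = 1 \<and>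
        norm (g - f) < e \<and> norm (S - T) < e"
      using near d g(1) by (meson less_le_trans)
  qed
qed

theorem corollary4:
  fixes B :: "('y::banach \<Rightarrow>\<^sub>L real) set"
    and \<B> :: "('w::banach \<Rightarrow>\<^sub>L 'y) set"
  assumes Y_nonzero: "\<exists>y::'y. y \<noteq> 0"
    and W_nonzero: "\<exists>w::'w. w \<noteq> 0"
    and B_sphere: "B \<subseteq> sphere 0 1"
    and closed_B: "closed B"
    and norming: "\<forall>y. norm y = (SUP f\<in>B. \<bar>blinfun_apply f y\<bar>)"
    and separation: "\<exists>\<epsilon>0>0. \<forall>\<epsilon>. 0 < \<epsilon> \<and> \<epsilon> < \<epsilon>0 \<longrightarrow>
        (\<exists>\<omega>>0. \<forall>f\<in>B. \<exists>y\<in>cball 0 1. \<forall>g\<in>B.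
            norm (g - f) \<ge> \<epsilon> \<longrightarrow> blinfun_apply f y - \<omega> \<ge> \<bar>blinfun_apply g y\<bar>)"
    and "subspace \<B>" and "closed \<B>"
    and "{F. finite_rank F} \<subseteq> \<B>"
  shows "(\<forall>S. \<exists>P. sigma_porous_in \<B> P \<and>
            {T \<in> \<B>. attains_strongly_norm_on (blinfun_adjoint S + blinfun_adjoint T) B} = \<B> - P) \<and>
         (\<forall>\<epsilon>>0. \<exists>\<eta>>0. \<forall>T\<in>\<B>. \<forall>f\<in>B.
            norm T = 1 \<and> norm (blinfun_adjoint T) = 1 \<and> norm (blinfun_adjoint T f) > 1 - \<eta> \<longrightarrow>
            (\<exists>S\<in>\<B>. \<exists>g\<in>B. norm S = 1 \<and> norm (blinfun_adjoint S) = 1 \<and>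
               norm (blinfun_adjoint S g) = 1 \<and> norm (g - f) < \<epsilon> \<and>
               norm (S - T) = norm (blinfun_adjoint S - blinfun_adjoint T) \<and> norm (S - T) < \<epsilon>))"
proof -
  have "B \<noteq> {}"
  proof
    assume "B = {}"
    then have "norm y = norm (0::'y)" for y :: 'y
      using norming by simp
    then show False using Y_nonzero by auto
  qed
  then have B: "norming B" using B_sphere norming by (simp add: norming_def)
  obtain e0 where e0: "e0 > 0"
    and sep: "\<And>e. 0 < e \<Longrightarrow> e < e0 \<Longrightarrow> \<exists>c>0. c \<le> 1 \<and> separated B e c"
    using separation separated_with_small_constant by metis
  define N where "N S = {T \<in> \<B>. \<not> attains_strongly_norm_on (blinfun_adjoint S + blinfun_adjoint T) B}" for S
  have porous: "sigma_porous_in \<B> (N S)" for S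
    unfolding N_def
    using sigma_porous_not_strongly_attaining[OF W_nonzero B closed_B e0 sep \<open>subspace \<B>\<close>] assms(9) by blast
  \<comment> \<open>the case \<open>S = 0\<close> of the porosity statement: norm attaining operators are dense\<close>
  have dense: "\<exists>S\<in>\<B>. norm (S - T) < b \<and> (\<exists>g\<in>B. norm (blinfun_adjoint S g) = norm S)"
    if T: "T \<in> \<B>" and b: "b > 0" for T b
  proof -
    obtain U where U: "U \<in> \<B> - N 0" "dist U T < b"
      using dense_complement_of_sigma_porous[OF \<open>closed \<B>\<close> porous T b] by blast
    have "attains_strongly_norm_on (blinfun_adjoint U) B"
      using U(1) by (simp add: N_def blinfun_adjoint_add)
    then have "\<exists>g\<in>B. norm (blinfun_adjoint U g) = norm U"
      unfolding attains_strongly_norm_on_def using norm_blinfun_adjoint_eq[OF B, of U] by metis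
    then show ?thesis using U by (auto simp: dist_norm)
  qed
  have "\<exists>\<eta>>0. \<forall>T\<in>\<B>. \<forall>f\<in>B.
      norm T = 1 \<and> norm (blinfun_adjoint T) = 1 \<and> norm (blinfun_adjoint T f) > 1 - \<eta> \<longrightarrow>
      (\<exists>S\<in>\<B>. \<exists>g\<in>B. norm S = 1 \<and> norm (blinfun_adjoint S) = 1 \<and>
         norm (blinfun_adjoint S g) = 1 \<and> norm (g - f) < \<epsilon> \<and>
         norm (S - T) = norm (blinfun_adjoint S - blinfun_adjoint T) \<and> norm (S - T) < \<epsilon>)"
    if \<epsilon>: "\<epsilon> > 0" for \<epsilon>
  proof -
    define d where "d = min \<epsilon> e0 / 2"
    have d: "0 < d" "d < e0" "d \<le> \<epsilon>" using \<epsilon> e0 by (auto simp: d_def)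
    then obtain c where c: "0 < c" "c \<le> 1" "separated B d c" using sep by blast
    show ?thesis
      using Bishop_Phelps_Bollobas_of_dense[OF W_nonzero B c d(3) \<epsilon> \<open>subspace \<B>\<close> _ dense] assms(9)
      by (simp only: blinfun_adjoint_diff norm_blinfun_adjoint_eq[OF B]) blast
  qed
  moreover have "\<exists>P. sigma_porous_in \<B> P \<and>
      {T \<in> \<B>. attains_strongly_norm_on (blinfun_adjoint S + blinfun_adjoint T) B} = \<B> - P" for S
    using porous[of S] by (intro exI[of _ "N S"]) (auto simp: N_def)
  ultimately show ?thesis by blast
qed

end
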